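(* Let $S$ be a semigroup and let $\operatorname{Min}(S)$ be the set of all minimal left ideals of $S$. Then: (i) if the intersection ideal graph $\Gamma(S)$ is planar, then $|\operatorname{Min}(S)|\leq 3$; (ii) if $S$ is the union of $n$ minimal left ideals, then $\Gamma(S)$ is planar if and only if $n\leq 3$.
   Context: A left ideal of a semigroup $S$ is a non-empty subset $I\subseteq S$ with $SI\subseteq I$; it is nontrivial if $I\neq S$. The intersection of two left ideals is nontrivial if it is non-empty. Minimal left ideals are understood to be nontrivial: a nontrivial left ideal is minimal if it does not properly contain any left ideal of $S$. The intersection ideal graph $\Gamma(S)$ is the simple undirected graph whose vertices are the nontrivial left ideals of $S$, with two distinct vertices $I,J$ adjacent if and only if $I\cap J$ is nontrivial. "Union of $n$ minimal left ideals" means the union of $n$ pairwise distinct minimal left ideals. A graph is planar if it can be drawn in the plane without edge crossings. *)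

theory Defs
  imports "HOL-Analysis.Analysis"
begin

text \<open>The semigroup \<open>S\<close> is the type \<open>'a::semigroup_mult\<close>, so that \<open>S = UNIV\<close>.\<close>

definition left_ideal :: "'a::semigroup_mult set \<Rightarrow> bool" where
  "left_ideal I \<longleftrightarrow> I \<noteq> {} \<and> (\<forall>s. \<forall>x\<in>I. s * x \<in> I)"

definition nontrivial_left_ideal :: "'a::semigroup_mult set \<Rightarrow> bool" where
  "nontrivial_left_ideal I \<longleftrightarrow> left_ideal I \<and> I \<noteq> UNIV"

definition minimal_left_ideal :: "'a::semigroup_mult set \<Rightarrow> bool" where
  "minimal_left_ideal I \<longleftrightarrow> nontrivial_left_ideal I \<and> (\<nexists>J. left_ideal J \<and> J \<subset> I)"

definition Min_left_ideals :: "'a::semigroup_mult set set" where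
  "Min_left_ideals = {I. minimal_left_ideal I}"

text \<open>A simple undirected graph is given by its vertex set and its set of edges, each edge
  being the two-element set of its end vertices.\<close>

definition ideal_graph_verts :: "'a::semigroup_mult set set" where
  "ideal_graph_verts = {I. nontrivial_left_ideal I}"

definition ideal_graph_edges :: "'a::semigroup_mult set set set" where
  "ideal_graph_edges =
     {{I, J} | I J. I \<in> ideal_graph_verts \<and> J \<in> ideal_graph_verts \<and> I \<noteq> J \<and> I \<inter> J \<noteq> {}}"

text \<open>In a drawing without crossings, distinct vertices \<open>v\<close> are distinct points \<open>p v\<close>, every edge
  \<open>e\<close> is an arc \<open>g e\<close> (a homeomorphic image of the unit interval) joining the points of its two
  end vertices and passing through no other vertex, and two distinct edges meet at most in the
  points of their common end vertices. The graph need not be finite.\<close>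

definition plane_drawing ::
  "'v set \<Rightarrow> 'v set set \<Rightarrow> ('v \<Rightarrow> complex) \<Rightarrow> ('v set \<Rightarrow> real \<Rightarrow> complex) \<Rightarrow> bool" where
  "plane_drawing V E p g \<longleftrightarrow>
     inj_on p V \<and>
     (\<forall>e\<in>E. arc (g e) \<and> {pathstart (g e), pathfinish (g e)} = p ` e) \<and>
     (\<forall>e\<in>E. \<forall>v\<in>V. p v \<in> path_image (g e) \<longrightarrow> v \<in> e) \<and>
     (\<forall>e\<in>E. \<forall>f\<in>E. e \<noteq> f \<longrightarrow> path_image (g e) \<inter> path_image (g f) \<subseteq> p ` (e \<inter> f))"

definition planar :: "'v set \<Rightarrow> 'v set set \<Rightarrow> bool" where
  "planar V E \<longleftrightarrow> (\<exists>p g. plane_drawing V E p g)"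

end

theory Submission
  imports Defs
begin

text \<open>For (i), four minimal left ideals \<open>A, B, C, D\<close> are pairwise disjoint, so the four unions of
  three of them together with \<open>A \<union> B\<close> are nontrivial and pairwise intersecting: they span a \<open>K\<^sub>5\<close>.
  A plane drawing of \<open>K\<^sub>5\<close> contains a Jordan curve through all five vertices, and the five
  remaining edges are its chords. Each chord lies inside or outside the curve, and two chords with
  interlaced ends lie on opposite sides. Since the interlacing relation of the five chords is a
  cycle of odd length, this is impossible.

  For (ii), if \<open>S\<close> is a union of minimal left ideals, every left ideal is a union of some of them.
  With two of them there are no edges; with three, the graph is a hexagon with a triangle
  inscribed on alternate vertices.\<close>

section \<open>Theta graphs in the plane\<close>

text \<open>A closed curve with a chord, with the three arcs treated alike: any two form a Jordan
  curve and the third is its chord. Later arguments permute the roles of \<open>P\<close>,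
  \<open>Q\<close> and \<open>R\<close>.\<close>

definition theta_graph :: "complex \<Rightarrow> complex \<Rightarrow> (real \<Rightarrow> complex) \<Rightarrow> (real \<Rightarrow> complex) \<Rightarrow> (real \<Rightarrow> complex) \<Rightarrow> bool" where
  "theta_graph u w P Q R \<longleftrightarrow>
     arc P \<and> pathstart P = u \<and> pathfinish P = w \<and>
     arc Q \<and> pathstart Q = u \<and> pathfinish Q = w \<and>
     arc R \<and> pathstart R = u \<and> pathfinish R = w \<and>
     path_image P \<inter> path_image Q = {u, w} \<and>
     path_image P \<inter> path_image R = {u, w} \<and>
     path_image Q \<inter> path_image R = {u, w}"

lemma theta_graph_swap: "theta_graph u w P Q R \<Longrightarrow> theta_graph u w Q P R"
  by (auto simp: theta_graph_def)

lemma theta_graph_rotate: "theta_graph u w P Q R \<Longrightarrow> theta_graph u w Q R P"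
  by (auto simp: theta_graph_def)

text \<open>The Jordan curve theorem for the loop that runs along \<open>P\<close> and back along
  \<open>Q\<close>.\<close>

lemma inside_two_arcs:
  assumes "theta_graph u w P Q R"
  shows "inside (path_image P \<union> path_image Q) \<noteq> {}"
    and "connected (inside (path_image P \<union> path_image Q))"
    and "open (inside (path_image P \<union> path_image Q))"
    and "frontier (inside (path_image P \<union> path_image Q)) = path_image P \<union> path_image Q"
proof -
  let ?c = "P +++ reversepath Q"
  have "simple_path ?c"
    using assms unfolding theta_graph_def
    by (intro simple_path_join_loop) (auto intro: arc_reversepath)
  moreover have "pathfinish ?c = pathstart ?c"
    using assms by (auto simp: theta_graph_def)
  moreover have "path_image ?c = path_image P \<union> path_image Q"
    using assms by (auto simp: theta_graph_def path_image_join)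
  ultimately show
       "inside (path_image P \<union> path_image Q) \<noteq> {}"
       "connected (inside (path_image P \<union> path_image Q))"
       "open (inside (path_image P \<union> path_image Q))"
       "frontier (inside (path_image P \<union> path_image Q)) = path_image P \<union> path_image Q"
    using Jordan_inside_outside[of ?c] by auto
qed

lemma theta_graph_split_inside:
  assumes "theta_graph u w P Q R"
    and "path_image R \<inter> inside (path_image P \<union> path_image Q) \<noteq> {}"
  shows "inside (path_image P \<union> path_image R) \<inter> inside (path_image Q \<union> path_image R) = {}"
    and "inside (path_image P \<union> path_image R) \<union> inside (path_image Q \<union> path_image R) \<union>
           (path_image R - {u, w}) = inside (path_image P \<union> path_image Q)"
proof -
  have "u \<noteq> w"
    using assms(1) arc_distinct_ends unfolding theta_graph_def by blast
  then show "inside (path_image P \<union> path_image R) \<inter> inside (path_image Q \<union> path_image R) = {}"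
    and "inside (path_image P \<union> path_image R) \<union> inside (path_image Q \<union> path_image R) \<union>
           (path_image R - {u, w}) = inside (path_image P \<union> path_image Q)"
    using split_inside_simple_closed_curve[of P u w Q R] assms
    unfolding theta_graph_def by (metis arc_imp_simple_path)+
qed

lemma connected_subset_if_avoids_frontier:
  assumes "connected S" "S \<inter> T \<noteq> {}" "S \<inter> frontier T = {}"
  shows "S \<subseteq> T"
  using connected_Int_frontier[of S T] assms by auto

text \<open>If the two regions met, each would be connected and miss the frontier of the other, so
  they would coincide. Equal frontiers would then force \<open>Q\<close> into \<open>{u, w}\<close>,
  although an arc has points besides its ends.\<close>

lemma theta_graph_inside_not_shared:
  assumes th: "theta_graph u w P Q R"
    and R: "path_image R \<inter> inside (path_image P \<union> path_image Q) = {}"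
    and Q: "path_image Q \<inter> inside (path_image P \<union> path_image R) = {}"
  shows "inside (path_image P \<union> path_image Q) \<inter> inside (path_image P \<union> path_image R) = {}"
proof (rule ccontr)
  let ?A = "inside (path_image P \<union> path_image Q)"
  let ?B = "inside (path_image P \<union> path_image R)"
  assume meet: "?A \<inter> ?B \<noteq> {}"
  have th': "theta_graph u w P R Q"
    using th by (auto simp: theta_graph_def)
  note A = inside_two_arcs[OF th] and B = inside_two_arcs[OF th']
  have "?A \<inter> (path_image P \<union> path_image Q) = {}" "?B \<inter> (path_image P \<union> path_image R) = {}"
    using inside_no_overlap by blast+
  \<comment> \<open>The frontier of \<open>?B\<close> consists of \<open>P\<close>, which bounds
    \<open>?A\<close> as well, and of \<open>R\<close>, which misses \<open>?A\<close> by
    hypothesis; likewise with the roles exchanged.\<close>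
  then have "?A \<inter> frontier ?B = {}" "?B \<inter> frontier ?A = {}"
    unfolding A(4) B(4) using Q R by blast+
  then have "?A \<subseteq> ?B" "?B \<subseteq> ?A"
    using connected_subset_if_avoids_frontier[OF A(2), of ?B]
      connected_subset_if_avoids_frontier[OF B(2), of ?A] meet by (simp_all add: Int_commute)
  then have "frontier ?A = frontier ?B"
    by (intro arg_cong[of _ _ frontier] equalityI)
  then have "path_image P \<union> path_image Q = path_image P \<union> path_image R"
    unfolding A(4) B(4) .
  then have "path_image Q \<subseteq> path_image P \<union> path_image R"
    by (metis Un_upper2)
  moreover have "path_image P \<inter> path_image Q = {u, w}" "path_image Q \<inter> path_image R = {u, w}"
    using th unfolding theta_graph_def by simp_all
  ultimately have "path_image Q \<subseteq> {u, w}"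
    by blast
  moreover have "path_image Q - {pathstart Q, pathfinish Q} \<noteq> {}"
    using th nonempty_simple_path_endless arc_imp_simple_path unfolding theta_graph_def by metis
  ultimately show False
    using th unfolding theta_graph_def by auto
qed

text \<open>A point outside both cycles through \<open>R\<close> can be joined to infinity off each of them, hence,
  by Janiszewski's theorem, off the whole theta graph, because the two cycles meet exactly in the
  connected set \<open>R\<close>.\<close>

lemma theta_graph_inside_cover:
  assumes th: "theta_graph u w P Q R"
  shows "inside (path_image P \<union> path_image Q) \<subseteq>
    inside (path_image P \<union> path_image R) \<union> inside (path_image Q \<union> path_image R) \<union> path_image R"
proof (rule ccontr)
  let ?P = "path_image P" and ?Q = "path_image Q" and ?R = "path_image R"
  assume "\<not> ?thesis"
  then obtain p where p: "p \<in> inside (?P \<union> ?Q)" "p \<notin> inside (?P \<union> ?R)"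
      "p \<notin> inside (?Q \<union> ?R)" "p \<notin> ?R"
    by blast
  have arcs: "arc P" "arc Q" "arc R"
    using th by (auto simp: theta_graph_def)
  have cpt: "compact ?P" "compact ?Q" "compact ?R"
    using arcs compact_arc_image by auto
  have "p \<notin> ?P" "p \<notin> ?Q"
    using p(1) inside_no_overlap[of "?P \<union> ?Q"] by blast+
  with p have out: "p \<in> outside (?P \<union> ?R)" "p \<in> outside (?Q \<union> ?R)"
    using inside_Un_outside by blast+
  have "bounded (?P \<union> ?Q \<union> ?R)"
    using cpt by (simp add: compact_imp_bounded)
  \<comment> \<open>\<open>q\<close> plays the role of infinity: it lies outside the whole theta
    graph, hence outside each closed curve in it.\<close>
  then obtain q where q: "q \<in> outside (?P \<union> ?Q \<union> ?R)"
    using outside_bounded_nonempty by blast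
  have cc: "connected_component (- S) p q"
    if "compact S" "p \<in> outside S" "S \<subseteq> ?P \<union> ?Q \<union> ?R" for S
  proof -
    have "connected (outside S)"
      using that(1) by (simp add: connected_outside compact_imp_bounded)
    moreover have "q \<in> outside S"
      using q outside_mono[OF that(3)] by blast
    moreover have "outside S \<subseteq> - S"
      using outside_no_overlap by blast
    ultimately show ?thesis
      using that(2) unfolding connected_component_def by blast
  qed
  have "(?P \<union> ?R) \<inter> (?Q \<union> ?R) = ?R"
    using th unfolding theta_graph_def by blast
  then have "connected_component (- ((?P \<union> ?R) \<union> (?Q \<union> ?R))) p q"
    using cpt arcs out
    by (intro Janiszewski cc) (auto simp: compact_imp_closed connected_arc_image)
  then have "connected_component (- (?P \<union> ?Q)) p q"
    by (rule connected_component_of_subset) auto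
  moreover have "q \<in> outside (?P \<union> ?Q)"
    using q outside_mono[of "?P \<union> ?Q" "?P \<union> ?Q \<union> ?R"] by blast
  ultimately have "p \<in> outside (?P \<union> ?Q)"
    using outside_same_component connected_component_sym by metis
  with p(1) show False
    using inside_Int_outside by blast
qed

text \<open>If no arc entered the region bounded by the other two, the region of \<open>P\<close>
  and \<open>Q\<close> would be disjoint from the other two regions and from \<open>R\<close>. But
  it is nonempty and covered by these three sets.\<close>

lemma theta_graph_trichotomy:
  assumes th: "theta_graph u w P Q R"
    and R: "path_image R \<inter> inside (path_image P \<union> path_image Q) = {}"
  shows "path_image P \<inter> inside (path_image Q \<union> path_image R) \<noteq> {} \<or>
    path_image Q \<inter> inside (path_image P \<union> path_image R) \<noteq> {}"
proof (rule ccontr)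
  assume "\<not> ?thesis"
  then have
    P: "path_image P \<inter> inside (path_image Q \<union> path_image R) = {}" and
    Q: "path_image Q \<inter> inside (path_image P \<union> path_image R) = {}"
    by auto
  have "inside (path_image P \<union> path_image Q) \<inter> inside (path_image P \<union> path_image R) = {}"
    by (rule theta_graph_inside_not_shared[OF th R Q])
  moreover have "inside (path_image P \<union> path_image Q) \<inter> inside (path_image Q \<union> path_image R) = {}"
    using theta_graph_inside_not_shared[OF theta_graph_swap[OF th] _ P] R
    by (simp add: Un_commute)
  ultimately show False
    using theta_graph_inside_cover[OF th] inside_two_arcs(1)[OF th] R by blast
qed

section \<open>Chords with interlaced ends on a closed curve\<close>

lemma arc_subset_closure_endless:
  assumes "arc g"
  shows "path_image g \<subseteq> closure (path_image g - {pathstart g, pathfinish g})"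
proof -
  have "path_image g = g ` closure {0<..<1}"
    by (simp add: path_image_def)
  also have "\<dots> \<subseteq> closure (g ` {0<..<1})"
    using assms by (intro image_closure_subset)
      (auto simp: arc_def path_def closure_subset)
  also have "g ` {0<..<1} = path_image g - {pathstart g, pathfinish g}"
    using assms simple_path_endless arc_imp_simple_path by metis
  finally show ?thesis .
qed

text \<open>Every point of \<open>Y\<close> is a limit of the open arc, and the closure of
  \<open>inside K\<close> adds only points of \<open>K\<close>.\<close>

lemma arc_end_in_inside:
  fixes Y :: "real \<Rightarrow> 'a::real_normed_vector"
  assumes "arc Y" "closed K" "path_image Y - {pathstart Y, pathfinish Y} \<subseteq> inside K"
    and "d \<in> path_image Y" "d \<notin> K"
  shows "d \<in> inside K"
  using arc_subset_closure_endless[OF assms(1)] closure_mono[OF assms(3)]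
    closure_inside_subset[OF assms(2)] assms(4,5) by blast

text \<open>\<open>P\<close> cuts the region of \<open>Q\<close> and \<open>R\<close> into two
  halves. The open arc of \<open>Y\<close> starts at \<open>b\<close> within that region and cannot
  leave it, so if it avoids the half at \<open>P\<close> and \<open>Q\<close> it stays in the half
  at \<open>P\<close> and \<open>R\<close>. Then its end \<open>d\<close> lies there too, although
  \<open>d\<close> is on the boundary arc \<open>Q\<close>.\<close>

lemma no_crossing_if_side_inside:
  assumes th: "theta_graph u w P Q R"
    and P: "path_image P \<inter> inside (path_image Q \<union> path_image R) \<noteq> {}"
    and Y: "arc Y" "{pathstart Y, pathfinish Y} = {b, d}"
      "path_image Y \<inter> (path_image P \<union> path_image Q \<union> path_image R) = {b, d}"
    and b: "b \<in> path_image P - {u, w}" and d: "d \<in> path_image Q - {u, w}"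
  shows "path_image Y \<inter> inside (path_image P \<union> path_image Q) \<noteq> {}"
proof
  let ?P = "path_image P" and ?Q = "path_image Q" and ?R = "path_image R"
  let ?Y = "path_image Y - {b, d}"
  assume none: "path_image Y \<inter> inside (?P \<union> ?Q) = {}"
  note QR = theta_graph_rotate[OF th]
  note split = theta_graph_split_inside[OF QR P]
  have conn: "connected ?Y"
    using connected_simple_path_endless[of Y] Y(1,2) arc_imp_simple_path by metis
  have "b \<in> inside (?Q \<union> ?R)"
    using b split(2) by blast
  moreover have "b \<in> closure ?Y"
    using arc_subset_closure_endless[OF Y(1)] Y(2,3) by auto
  \<comment> \<open>The region is open and contains \<open>b\<close>, a limit of the open arc, so
    the open arc enters it.\<close>
  ultimately have "?Y \<inter> inside (?Q \<union> ?R) \<noteq> {}"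
    using inside_two_arcs(3)[OF QR] open_Int_closure_eq_empty[of "inside (?Q \<union> ?R)" ?Y] by blast
  then have "?Y \<subseteq> inside (?Q \<union> ?R)"
    using connected_subset_if_avoids_frontier[OF conn] inside_two_arcs(4)[OF QR] Y(3) by blast
  moreover have "?Y \<inter> ?P = {}"
    using Y(3) by blast
  ultimately have "?Y \<subseteq> inside (?R \<union> ?P)"
    using split(2) none by (auto simp: Un_commute)
  moreover have "d \<in> path_image Y" "d \<notin> ?R \<union> ?P"
    using Y(3) d th unfolding theta_graph_def by blast+
  moreover have "closed (?R \<union> ?P)"
    using th by (auto simp: theta_graph_def closed_arc_image)
  ultimately have "d \<in> inside (?R \<union> ?P)"
    using arc_end_in_inside[OF Y(1)] Y(2) by auto
  then have "d \<in> inside (?Q \<union> ?R)"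
    using split(2) by blast
  then show False
    using d inside_no_overlap[of "?Q \<union> ?R"] by blast
qed

text \<open>If \<open>R\<close> is not inside, then \<open>P\<close> or \<open>Q\<close> runs inside
  the curve formed with the other two arcs, and the previous lemma puts part of \<open>Y\<close>
  inside. If \<open>R\<close> is inside, it separates the region into two halves, one bounded away
  from \<open>b\<close> and the other from \<open>d\<close>, so \<open>Y\<close> cannot run
  there.\<close>

lemma crossing_chords_opposite_sides:
  assumes th: "theta_graph u w P Q R"
    and Y: "arc Y" "{pathstart Y, pathfinish Y} = {b, d}"
      "path_image Y \<inter> (path_image P \<union> path_image Q \<union> path_image R) = {b, d}"
    and b: "b \<in> path_image P - {u, w}" and d: "d \<in> path_image Q - {u, w}"
  shows "path_image R \<inter> inside (path_image P \<union> path_image Q) \<noteq> {} \<longleftrightarrow>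
    path_image Y \<inter> inside (path_image P \<union> path_image Q) = {}"
proof (cases "path_image R \<inter> inside (path_image P \<union> path_image Q) = {}")
  case True
  have "path_image Y \<inter> inside (path_image P \<union> path_image Q) \<noteq> {}"
    using theta_graph_trichotomy[OF th True]
  proof
    assume "path_image P \<inter> inside (path_image Q \<union> path_image R) \<noteq> {}"
    then show ?thesis
      using no_crossing_if_side_inside[OF th _ Y b d] by blast
  next
    assume "path_image Q \<inter> inside (path_image P \<union> path_image R) \<noteq> {}"
    moreover have "{pathstart Y, pathfinish Y} = {d, b}"
      "path_image Y \<inter> (path_image Q \<union> path_image P \<union> path_image R) = {d, b}"
      using Y by auto
    ultimately show ?thesis
      using no_crossing_if_side_inside[OF theta_graph_swap[OF th] _ Y(1) _ _ d b]
      by (simp add: Un_commute)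
  qed
  with True show ?thesis by simp
next
  case False
  let ?P = "path_image P" and ?Q = "path_image Q" and ?R = "path_image R"
  let ?Y = "path_image Y - {b, d}"
  note split = theta_graph_split_inside[OF th False]
  have PR: "theta_graph u w P R Q" "theta_graph u w Q R P"
    using th by (auto simp: theta_graph_def)
  have not_on: "z \<notin> inside (?P \<union> ?Q)" if "z \<in> {b, d}" for z
    using that b d inside_no_overlap[of "?P \<union> ?Q"] by blast
  have ends: "b \<in> path_image Y" "d \<in> path_image Y"
    using Y(3) by blast+
  have "d \<notin> ?P" "b \<notin> ?Q" "d \<notin> ?R" "b \<notin> ?R"
    using th b d unfolding theta_graph_def by blast+
  have "path_image Y \<inter> inside (?P \<union> ?Q) = {}"
  proof (rule ccontr)
    assume "path_image Y \<inter> inside (?P \<union> ?Q) \<noteq> {}"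
    then obtain y where y: "y \<in> ?Y" "y \<in> inside (?P \<union> ?Q)"
      using not_on by blast
    have conn: "connected ?Y"
      using connected_simple_path_endless[of Y] Y(1,2) arc_imp_simple_path by metis
    have "y \<notin> ?R"
      using y(1) Y(3) by blast
    with y split(2) consider "y \<in> inside (?P \<union> ?R)" | "y \<in> inside (?Q \<union> ?R)"
      by blast
    then show False
    proof cases
      \<comment> \<open>The boundary of this half misses \<open>d\<close>, so \<open>d\<close> would
        be an inner point of it, although it lies on \<open>Q\<close>. The other half fails in the
        same way at \<open>b\<close>.\<close>
      case 1
      then have "?Y \<subseteq> inside (?P \<union> ?R)"
        using connected_subset_if_avoids_frontier[OF conn] inside_two_arcs(4)[OF PR(1)] Y(3) y(1)
        by blast
      moreover have "closed (?P \<union> ?R)"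
        using th by (auto simp: theta_graph_def closed_arc_image)
      moreover have "d \<notin> ?P \<union> ?R"
        using \<open>d \<notin> ?P\<close> \<open>d \<notin> ?R\<close> by blast
      ultimately have "d \<in> inside (?P \<union> ?R)"
        using arc_end_in_inside[OF Y(1)] Y(2) ends by simp
      then show False
        using not_on split(2) by blast
    next
      case 2
      then have "?Y \<subseteq> inside (?Q \<union> ?R)"
        using connected_subset_if_avoids_frontier[OF conn] inside_two_arcs(4)[OF PR(2)] Y(3) y(1)
        by blast
      moreover have "closed (?Q \<union> ?R)"
        using th by (auto simp: theta_graph_def closed_arc_image)
      moreover have "b \<notin> ?Q \<union> ?R"
        using \<open>b \<notin> ?Q\<close> \<open>b \<notin> ?R\<close> by blast
      ultimately have "b \<in> inside (?Q \<union> ?R)"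
        using arc_end_in_inside[OF Y(1)] Y(2) ends by simp
      then show False
        using not_on split(2) by blast
    qed
  qed
  with False show ?thesis by simp
qed

section \<open>Plane drawings of complete graphs\<close>

definition complete_edges :: "'v set \<Rightarrow> 'v set set" where
  "complete_edges V = {{x, y} | x y. x \<in> V \<and> y \<in> V \<and> x \<noteq> y}"

lemma planar_subgraph:
  assumes "planar V E" "V' \<subseteq> V" "E' \<subseteq> E"
  shows "planar V' E'"
proof -
  obtain p g where "plane_drawing V E p g"
    using assms(1) by (auto simp: planar_def)
  then have "plane_drawing V' E' p g"
    using assms(2,3) inj_on_subset unfolding plane_drawing_def by (metis subsetD)
  then show ?thesis
    by (auto simp: planar_def)
qed

text \<open>The definition of a drawing bounds the intersection from above; the ends of the arcs
  give the reverse inclusion. With equality, intersections of arcs can be computed from shared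
  vertices.\<close>

lemma plane_drawing_meet:
  assumes "plane_drawing V E p g" "e \<in> E" "f \<in> E" "e \<noteq> f"
  shows "path_image (g e) \<inter> path_image (g f) = p ` (e \<inter> f)"
proof
  show "path_image (g e) \<inter> path_image (g f) \<subseteq> p ` (e \<inter> f)"
    using assms unfolding plane_drawing_def by blast
  have "p ` e' \<subseteq> path_image (g e')" if "e' \<in> E" for e'
  proof -
    have "p ` e' = {pathstart (g e'), pathfinish (g e')}"
      using assms(1) that unfolding plane_drawing_def by simp
    then show ?thesis
      by (simp add: pathstart_in_path_image pathfinish_in_path_image)
  qed
  then show "p ` (e \<inter> f) \<subseteq> path_image (g e) \<inter> path_image (g f)"
    using assms(2,3) by blast
qed

text \<open>Edges are unordered, so the drawn arc may run either way and is reversed when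
  necessary.\<close>

lemma plane_drawing_arc_between:
  assumes "plane_drawing V E p g" "{a, b} \<in> E"
  obtains h where "arc h" "pathstart h = p a" "pathfinish h = p b"
    "path_image h = path_image (g {a, b})"
proof -
  have g: "arc (g {a, b})" "{pathstart (g {a, b}), pathfinish (g {a, b})} = {p a, p b}"
    using assms unfolding plane_drawing_def by auto
  show thesis
  proof (cases "pathstart (g {a, b}) = p a")
    case True
    then have "pathfinish (g {a, b}) = p b"
      using g(2) by (auto simp: doubleton_eq_iff)
    with True g(1) that show thesis by blast
  next
    case False
    then have "pathstart (g {a, b}) = p b" "pathfinish (g {a, b}) = p a"
      using g(2) by (auto simp: doubleton_eq_iff)
    with g(1) that[of "reversepath (g {a, b})"] show thesis
      by (simp add: arc_reversepath)
  qed
qed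

text \<open>The chord from \<open>a\<close> to \<open>c\<close> and the two sides of the pentagon
  between them form a theta graph, whose sides contain \<open>b\<close> and \<open>d\<close>
  respectively.\<close>

lemma K5_chords_opposite_sides:
  fixes p :: "'v \<Rightarrow> complex"
  assumes dr: "plane_drawing {a, b, c, d, e} (complete_edges {a, b, c, d, e}) p g"
    and dist: "distinct [a, b, c, d, e]"
  defines "A \<equiv> \<lambda>x y. path_image (g {x, y})"
  defines "C \<equiv> A a b \<union> A b c \<union> A c d \<union> A d e \<union> A e a"
  shows "A a c \<inter> inside C \<noteq> {} \<longleftrightarrow> A b d \<inter> inside C = {}"
proof -
  let ?V = "{a, b, c, d, e}"
  have E: "{x, y} \<in> complete_edges ?V" if "x \<in> ?V" "y \<in> ?V" "x \<noteq> y" for x y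
    using that unfolding complete_edges_def by blast
  have ex: "\<exists>h. arc h \<and> pathstart h = p x \<and> pathfinish h = p y \<and> path_image h = A x y"
    if "x \<in> ?V" "y \<in> ?V" "x \<noteq> y" for x y
    using plane_drawing_arc_between[OF dr E[OF that]] unfolding A_def by metis
  \<comment> \<open>Joining paths needs directions: for each ordered pair of distinct vertices this
    fixes an arc starting at the first one.\<close>
  define h where "h x y = (SOME h. arc h \<and> pathstart h = p x \<and> pathfinish h = p y \<and>
      path_image h = A x y)" for x y
  have meet: "A x y \<inter> A z w = p ` ({x, y} \<inter> {z, w})"
    if "x \<in> ?V" "y \<in> ?V" "x \<noteq> y" "z \<in> ?V" "w \<in> ?V" "z \<noteq> w" "{x, y} \<noteq> {z, w}" for x y z w
    using plane_drawing_meet[OF dr E[OF that(1-3)] E[OF that(4-6)] that(7)]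
    unfolding A_def .
  have comm: "A x y = A y x" for x y
    unfolding A_def by (simp add: insert_commute)
  have inj: "p a \<noteq> p b" "p a \<noteq> p c" "p a \<noteq> p d" "p a \<noteq> p e" "p b \<noteq> p c" "p b \<noteq> p d"
     "p b \<noteq> p e" "p c \<noteq> p d" "p c \<noteq> p e" "p d \<noteq> p e"
    using dr dist unfolding plane_drawing_def inj_on_def by auto
  have ne: "a \<noteq> b" "a \<noteq> c" "a \<noteq> d" "a \<noteq> e" "b \<noteq> c" "b \<noteq> d" "b \<noteq> e" "c \<noteq> d" "c \<noteq> e" "d \<noteq> e"
    using dist by auto
  note [simp] = ne ne[symmetric]
  define P where "P = h a b +++ h b c"
  define Q where "Q = h a e +++ (h e d +++ h d c)"
  have [simp]: "arc (h x y)" "pathstart (h x y) = p x" "pathfinish (h x y) = p y"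
      "path_image (h x y) = A x y" if "x \<in> ?V" "y \<in> ?V" "x \<noteq> y" for x y
    using someI_ex[OF ex[OF that]] unfolding h_def by auto
  have imQ': "path_image (h e d +++ h d c) = A e d \<union> A d c"
    using dist by (subst path_image_join) auto
  have im: "path_image P = A a b \<union> A b c" "path_image Q = A a e \<union> (A e d \<union> A d c)"
    using dist imQ' unfolding P_def Q_def by (subst path_image_join; auto)+
  have "arc P"
    using dist meet[of a b b c] unfolding P_def
    by (intro arc_join) (auto simp: doubleton_eq_iff)
  have "arc (h e d +++ h d c)"
    using dist meet[of e d d c]
    by (intro arc_join) (auto simp: doubleton_eq_iff)
  then have "arc Q"
    using dist imQ' meet[of e d d c] meet[of a e e d] meet[of a e d c] unfolding Q_def
    by (intro arc_join) (auto simp: doubleton_eq_iff)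
  have theta: "theta_graph (p a) (p c) P Q (h a c)"
  proof -
    \<comment> \<open>Distributing over the single edges leaves pairs of arcs, whose intersections
      \<open>meet\<close> reduces to common vertices.\<close>
    have "path_image P \<inter> path_image Q = {p a, p c}"
      unfolding im Int_Un_distrib Int_Un_distrib2
      by (simp add: meet doubleton_eq_iff)
    moreover have "path_image P \<inter> path_image (h a c) = {p a, p c}"
      unfolding im Int_Un_distrib Int_Un_distrib2
      by (simp add: meet doubleton_eq_iff)
    moreover have "path_image Q \<inter> path_image (h a c) = {p a, p c}"
      unfolding im Int_Un_distrib Int_Un_distrib2
      by (simp add: meet doubleton_eq_iff)
    ultimately show ?thesis
      using \<open>arc P\<close> \<open>arc Q\<close> dist unfolding theta_graph_def by (simp add: P_def Q_def)
  qed
  have Y: "path_image (h b d) \<inter> (path_image P \<union> path_image Q \<union> path_image (h a c)) = {p b, p d}"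
    unfolding im Int_Un_distrib Int_Un_distrib2
    by (simp add: meet doubleton_eq_iff)
  have "p b \<in> path_image P" "p d \<in> path_image Q"
    using Y unfolding im using dist
      pathfinish_in_path_image[of "h a b"] pathfinish_in_path_image[of "h e d"] by auto
  then have "path_image (h a c) \<inter> inside (path_image P \<union> path_image Q) \<noteq> {} \<longleftrightarrow>
      path_image (h b d) \<inter> inside (path_image P \<union> path_image Q) = {}"
    using dist inj by (intro crossing_chords_opposite_sides[OF theta _ _ Y]) auto
  moreover have "path_image P \<union> path_image Q = C"
    unfolding im C_def using comm by blast
  ultimately show ?thesis
    using dist by simp
qed

theorem K5_not_planar:
  assumes dist: "distinct [a, b, c, d, e]"
  shows "\<not> planar {a, b, c, d, e} (complete_edges {a, b, c, d, e})"
proof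
  assume "planar {a, b, c, d, e} (complete_edges {a, b, c, d, e})"
  then obtain p g where dr: "plane_drawing {a, b, c, d, e} (complete_edges {a, b, c, d, e}) p g"
    by (auto simp: planar_def)
  define A where "A = (\<lambda>x y. path_image (g {x, y}))"
  define C where "C = A a b \<union> A b c \<union> A c d \<union> A d e \<union> A e a"
  define s where "s = (\<lambda>x y. A x y \<inter> inside C \<noteq> {})"
  have comm: "A x y = A y x" for x y
    unfolding A_def by (simp add: insert_commute)
  \<comment> \<open>Relabelling the pentagon by a rotation leaves \<open>C\<close> unchanged, so the
    same curve serves for all five pairs of chords.\<close>
  have step: "s v x \<noteq> s w y"
    if "{v, w, x, y, z} = {a, b, c, d, e}" "distinct [v, w, x, y, z]"
      "A v w \<union> A w x \<union> A x y \<union> A y z \<union> A z v = C" for v w x y z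
    using K5_chords_opposite_sides[of v w x y z p g] that dr unfolding s_def A_def by auto
  have "s a c \<noteq> s b d"
    using dist by (intro step[of a b c d e]) (auto simp: C_def)
  moreover have "s b d \<noteq> s c e"
    using dist by (intro step[of b c d e a]) (auto simp: C_def)
  moreover have "s c e \<noteq> s d a"
    using dist by (intro step[of c d e a b]) (auto simp: C_def)
  moreover have "s d a \<noteq> s e b"
    using dist by (intro step[of d e a b c]) (auto simp: C_def)
  moreover have "s e b \<noteq> s a c"
    using dist by (intro step[of e a b c d]) (auto simp: C_def)
  \<comment> \<open>Five truth values arranged in a cycle cannot all differ from their
    successors.\<close>
  ultimately show False
    by blast
qed

section \<open>Straight-line drawings\<close>

lemma planar_straight_line:
  fixes p :: "'v \<Rightarrow> complex"
  assumes inj: "inj_on p V"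
    and E: "\<And>e. e \<in> E \<Longrightarrow> \<exists>x\<in>V. \<exists>y\<in>V. x \<noteq> y \<and> e = {x, y}"
    and meet: "\<And>e f. e \<in> E \<Longrightarrow> f \<in> E \<Longrightarrow> e \<noteq> f \<Longrightarrow>
      convex hull (p ` e) \<inter> convex hull (p ` f) \<subseteq> p ` (e \<inter> f)"
    and vert: "\<And>e. e \<in> E \<Longrightarrow> convex hull (p ` e) \<inter> p ` V \<subseteq> p ` e"
  shows "planar V E"
proof -
  have "\<exists>h. arc h \<and> {pathstart h, pathfinish h} = p ` e \<and> path_image h = convex hull (p ` e)"
    if e: "e \<in> E" for e
  proof -
    obtain x y where xy: "x \<in> V" "y \<in> V" "x \<noteq> y" "e = {x, y}"
      using E[OF e] by blast
    then have "p x \<noteq> p y"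
      using inj by (auto dest: inj_onD)
    with xy(4) show ?thesis
      by (intro exI[of _ "linepath (p x) (p y)"]) (simp add: segment_convex_hull)
  qed
  then obtain g where g: "\<forall>e\<in>E. arc (g e) \<and> {pathstart (g e), pathfinish (g e)} = p ` e \<and>
      path_image (g e) = convex hull (p ` e)"
    by metis
  have "v \<in> e" if "e \<in> E" "v \<in> V" "p v \<in> path_image (g e)" for e v
  proof -
    have "p v \<in> p ` e"
      using vert[OF that(1)] that g by auto
    moreover have "e \<subseteq> V"
      using E[OF that(1)] by auto
    ultimately show ?thesis
      using inj_on_image_mem_iff[OF inj that(2)] by blast
  qed
  then have "plane_drawing V E p g"
    using inj g meet unfolding plane_drawing_def by simp
  then show ?thesis
    by (auto simp: planar_def)
qed

section \<open>A straight-line drawing of a hexagon with an inscribed triangle\<close>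

definition hexagon_points :: "complex set" where
  "hexagon_points = {Complex 1 0, Complex 1 1, Complex 0 1, Complex (-1) 0,
     Complex (-1) (-1), Complex 0 (-1)}"

text \<open>The first six edges are the sides in cyclic order; the last three form the triangle on
  the points used for unions of two minimal left ideals.\<close>

definition hexagon_edges :: "complex set set" where
  "hexagon_edges =
     {{Complex 1 0, Complex 1 1}, {Complex 1 1, Complex 0 1}, {Complex 0 1, Complex (-1) 0},
      {Complex (-1) 0, Complex (-1) (-1)}, {Complex (-1) (-1), Complex 0 (-1)},
      {Complex 0 (-1), Complex 1 0},
      {Complex 1 1, Complex (-1) 0}, {Complex (-1) 0, Complex 0 (-1)},
      {Complex 0 (-1), Complex 1 1}}"

lemma convex_hull_pair_coords:
  assumes "z \<in> convex hull {a, b}"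
  obtains t where "0 \<le> t" "t \<le> 1" "Re z = Re a + t * (Re b - Re a)"
    "Im z = Im a + t * (Im b - Im a)"
proof -
  obtain t where t: "0 \<le> t" "t \<le> 1" "z = (1 - t) *\<^sub>R a + t *\<^sub>R b"
    using assms by (auto simp: segment_convex_hull[symmetric] in_segment)
  then show thesis
    by (intro that[of t]) (simp_all only: t(3), simp_all add: algebra_simps)
qed

text \<open>Each segment is described by a linear equation and bounds on one coordinate, so that
  crossings become questions of linear arithmetic.\<close>

lemma hexagon_hull_cases:
  assumes "e \<in> hexagon_edges" "z \<in> convex hull e"
  shows
    "e = {Complex 1 0, Complex 1 1} \<and> Re z = 1 \<and> 0 \<le> Im z \<and> Im z \<le> 1 \<or>
     e = {Complex 1 1, Complex 0 1} \<and> Im z = 1 \<and> 0 \<le> Re z \<and> Re z \<le> 1 \<or>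
     e = {Complex 0 1, Complex (-1) 0} \<and> Im z = Re z + 1 \<and> -1 \<le> Re z \<and> Re z \<le> 0 \<or>
     e = {Complex (-1) 0, Complex (-1) (-1)} \<and> Re z = -1 \<and> -1 \<le> Im z \<and> Im z \<le> 0 \<or>
     e = {Complex (-1) (-1), Complex 0 (-1)} \<and> Im z = -1 \<and> -1 \<le> Re z \<and> Re z \<le> 0 \<or>
     e = {Complex 0 (-1), Complex 1 0} \<and> Im z = Re z - 1 \<and> 0 \<le> Re z \<and> Re z \<le> 1 \<or>
     e = {Complex 1 1, Complex (-1) 0} \<and> Re z = 2 * Im z - 1 \<and> 0 \<le> Im z \<and> Im z \<le> 1 \<or>
     e = {Complex (-1) 0, Complex 0 (-1)} \<and> Im z = -1 - Re z \<and> -1 \<le> Re z \<and> Re z \<le> 0 \<or>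
     e = {Complex 0 (-1), Complex 1 1} \<and> Im z = 2 * Re z - 1 \<and> 0 \<le> Re z \<and> Re z \<le> 1"
  using assms(1)[unfolded hexagon_edges_def] assms(2)
  apply (elim insertE emptyE)
  apply (hypsubst, elim convex_hull_pair_coords, simp)+
  done

lemma mem_Int_if_coords:
  "Re z = x \<Longrightarrow> Im z = y \<Longrightarrow> Complex x y \<in> e \<Longrightarrow> Complex x y \<in> f \<Longrightarrow> z \<in> e \<inter> f"
  by (metis IntI complex.exhaust_sel)

lemma hexagon_edges_meet:
  assumes "e \<in> hexagon_edges" "f \<in> hexagon_edges" "e \<noteq> f"
  shows "convex hull e \<inter> convex hull f \<subseteq> e \<inter> f"
proof
  fix z
  assume z: "z \<in> convex hull e \<inter> convex hull f"
  show "z \<in> e \<inter> f"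
    using hexagon_hull_cases[OF assms(1), of z] hexagon_hull_cases[OF assms(2), of z] z assms(3)
    apply (elim IntE)
    apply (drule (1) meta_mp)+
    \<comment> \<open>For each pair of edges, either they are equal, or the linear conditions are
      contradictory, or they determine one of the six points, which is then an end of both.\<close>
    apply (elim disjE conjE; hypsubst;
      ((erule notE, rule refl) | (rule FalseE, linarith)
      | (rule mem_Int_if_coords[of _ 1 0], linarith, linarith, simp, simp)
      | (rule mem_Int_if_coords[of _ 1 1], linarith, linarith, simp, simp)
      | (rule mem_Int_if_coords[of _ 0 1], linarith, linarith, simp, simp)
      | (rule mem_Int_if_coords[of _ "-1" 0], linarith, linarith, simp, simp)
      | (rule mem_Int_if_coords[of _ "-1" "-1"], linarith, linarith, simp, simp)
      | (rule mem_Int_if_coords[of _ 0 "-1"], linarith, linarith, simp, simp)))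
    done
qed

lemma hexagon_edges_commute: "{a, b} \<in> hexagon_edges \<Longrightarrow> {b, a} \<in> hexagon_edges"
  by (simp add: insert_commute)

text \<open>Every vertex is an end of at least two edges. A vertex on the segment of
  \<open>e\<close> is thus also an end of some other edge, and distinct edges meet only in common
  ends.\<close>

lemma hexagon_edges_vert:
  assumes "e \<in> hexagon_edges"
  shows "convex hull e \<inter> hexagon_points \<subseteq> e"
proof
  fix z
  assume z: "z \<in> convex hull e \<inter> hexagon_points"
  then obtain f where "f \<in> hexagon_edges" "z \<in> f" "f \<noteq> e"
  proof -
    have "\<exists>f\<in>hexagon_edges. f \<noteq> e \<and> z \<in> f"
      using assms z unfolding hexagon_edges_def hexagon_points_def
      by (elim insertE emptyE IntE) (simp_all add: doubleton_eq_iff)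
    then show thesis using that by blast
  qed
  then show "z \<in> e"
    using hexagon_edges_meet[OF assms, of f] z hull_subset[of f convex] by blast
qed

text \<open>Stated for arbitrary sets: disjointness of the three nonempty blocks already decides
  which vertices are adjacent.\<close>

lemma planar_three_sets:
  fixes A B C :: "'a set"
  assumes ne: "A \<noteq> {}" "B \<noteq> {}" "C \<noteq> {}"
    and disj: "A \<inter> B = {}" "A \<inter> C = {}" "B \<inter> C = {}"
    and V_def: "V = {A, B, C, A \<union> B, B \<union> C, A \<union> C}"
  shows "planar V {{I, J} | I J. I \<in> V \<and> J \<in> V \<and> I \<noteq> J \<and> I \<inter> J \<noteq> {}}"
    (is "planar V ?E")
proof -
  \<comment> \<open>Sums of corner positions: \<open>A, B, C\<close> sit at \<open>1, \<i>, -1 - \<i>\<close>, and unions at the sums.\<close>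
  define p :: "'a set \<Rightarrow> complex" where
    "p I = Complex (of_bool (A \<subseteq> I) - of_bool (C \<subseteq> I)) (of_bool (B \<subseteq> I) - of_bool (C \<subseteq> I))" for I
  have sub: "\<not> A \<subseteq> B" "\<not> A \<subseteq> C" "\<not> A \<subseteq> B \<union> C" "\<not> B \<subseteq> A" "\<not> B \<subseteq> C" "\<not> B \<subseteq> A \<union> C"
      "\<not> C \<subseteq> A" "\<not> C \<subseteq> B" "\<not> C \<subseteq> A \<union> B"
    using ne disj by blast+
  have p: "p A = Complex 1 0" "p B = Complex 0 1" "p C = Complex (-1) (-1)"
    "p (A \<union> B) = Complex 1 1" "p (B \<union> C) = Complex (-1) 0" "p (A \<union> C) = Complex 0 (-1)"
    using sub by (simp_all add: p_def)
  have inj: "inj_on p V"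
    unfolding V_def by (simp add: inj_on_def p)
  have pV: "p ` V = hexagon_points"
    unfolding V_def hexagon_points_def by (auto simp: p)
  have mem: "{p A, p (A \<union> B)} \<in> hexagon_edges" "{p (A \<union> B), p B} \<in> hexagon_edges"
    "{p B, p (B \<union> C)} \<in> hexagon_edges" "{p (B \<union> C), p C} \<in> hexagon_edges"
    "{p C, p (A \<union> C)} \<in> hexagon_edges" "{p (A \<union> C), p A} \<in> hexagon_edges"
    "{p (A \<union> B), p (B \<union> C)} \<in> hexagon_edges" "{p (B \<union> C), p (A \<union> C)} \<in> hexagon_edges"
    "{p (A \<union> C), p (A \<union> B)} \<in> hexagon_edges"
    unfolding p hexagon_edges_def by (rule insertI1 | rule insertI2)+
  note mem = mem mem[THEN hexagon_edges_commute]
  have disj_sym: "B \<inter> A = {}" "C \<inter> A = {}" "C \<inter> B = {}"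
    using disj by (simp_all add: Int_commute)
  have disj_Un: "A \<inter> (B \<union> C) = {}" "B \<inter> (A \<union> C) = {}"
    "C \<inter> (A \<union> B) = {}" "(B \<union> C) \<inter> A = {}" "(A \<union> C) \<inter> B = {}" "(A \<union> B) \<inter> C = {}"
    by (simp_all add: Int_Un_distrib Int_Un_distrib2 disj disj_sym)
  \<comment> \<open>Of the 36 ordered pairs of vertices, 6 are equal, 12 are disjoint, and the other
    18 are the hexagon edges in both orders.\<close>
  have edge: "p ` e \<in> hexagon_edges" if e: "e \<in> ?E" for e
  proof -
    obtain I J where IJ: "e = {I, J}" "I \<in> V" "J \<in> V" "I \<noteq> J" "I \<inter> J \<noteq> {}"
      using e by blast
    show ?thesis
      using IJ(2-5) unfolding IJ(1) V_def
      apply (elim insertE emptyE; hypsubst)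
      apply ((erule notE, rule refl) | (erule notE, rule disj disj_sym disj_Un)
        | (simp only: image_insert image_empty mem))+
      done
  qed
  have sub_V: "e \<subseteq> V" if "e \<in> ?E" for e
    using that by blast
  show ?thesis
  proof (rule planar_straight_line[OF inj])
    fix e f
    assume ef: "e \<in> ?E" "f \<in> ?E" "e \<noteq> f"
    note V = sub_V[OF ef(1)] sub_V[OF ef(2)]
    have "p ` e \<noteq> p ` f"
      using inj_on_image_eq_iff[OF inj V] ef(3) by simp
    from hexagon_edges_meet[OF edge[OF ef(1)] edge[OF ef(2)] this]
    show "convex hull (p ` e) \<inter> convex hull (p ` f) \<subseteq> p ` (e \<inter> f)"
      unfolding inj_on_image_Int[OF inj V] .
  next
    fix e
    assume "e \<in> ?E"
    then show "convex hull (p ` e) \<inter> p ` V \<subseteq> p ` e"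
      unfolding pV by (intro hexagon_edges_vert edge)
  qed blast
qed

section \<open>Left ideals\<close>

lemma left_ideal_Un: "left_ideal I \<Longrightarrow> left_ideal J \<Longrightarrow> left_ideal (I \<union> J)"
  by (auto simp: left_ideal_def)

lemma left_ideal_Int: "left_ideal I \<Longrightarrow> left_ideal J \<Longrightarrow> I \<inter> J \<noteq> {} \<Longrightarrow> left_ideal (I \<inter> J)"
  by (auto simp: left_ideal_def)

lemma minimal_left_idealD:
  assumes "minimal_left_ideal I"
  shows "left_ideal I" "I \<noteq> {}" "I \<noteq> UNIV"
  using assms by (auto simp: minimal_left_ideal_def nontrivial_left_ideal_def left_ideal_def)

text \<open>A nonempty intersection is a left ideal inside \<open>N\<close>, so minimality makes it
  all of \<open>N\<close>.\<close>

lemma minimal_left_ideal_subset_or_disjoint: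
  assumes "minimal_left_ideal N" "left_ideal I"
  shows "N \<subseteq> I \<or> N \<inter> I = {}"
  using assms left_ideal_Int[OF minimal_left_idealD(1)[OF assms(1)] assms(2)]
  unfolding minimal_left_ideal_def by blast

lemma minimal_left_ideals_disjoint:
  assumes "minimal_left_ideal I" "minimal_left_ideal J" "I \<noteq> J"
  shows "I \<inter> J = {}"
  using minimal_left_ideal_subset_or_disjoint[OF assms(1) minimal_left_idealD(1)[OF assms(2)]]
    minimal_left_ideal_subset_or_disjoint[OF assms(2) minimal_left_idealD(1)[OF assms(1)]] assms(3)
  by blast

section \<open>Planarity of the intersection ideal graph\<close>

lemma four_minimal_left_ideals_not_planar:
  fixes A B C D :: "'a::semigroup_mult set"
  assumes min: "minimal_left_ideal A" "minimal_left_ideal B" "minimal_left_ideal C"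
      "minimal_left_ideal D"
    and dist: "distinct [A, B, C, D]"
  shows "\<not> planar (ideal_graph_verts :: 'a set set) ideal_graph_edges"
proof
  assume pl: "planar (ideal_graph_verts :: 'a set set) ideal_graph_edges"
  have disj: "A \<inter> B = {}" "A \<inter> C = {}" "A \<inter> D = {}" "B \<inter> C = {}" "B \<inter> D = {}" "C \<inter> D = {}"
    using min dist by (simp_all add: minimal_left_ideals_disjoint)
  have ne: "A \<noteq> {}" "B \<noteq> {}" "C \<noteq> {}" "D \<noteq> {}"
    using min minimal_left_idealD(2) by auto
  \<comment> \<open>One representative per ideal settles everything below: that the unions are
    proper, distinct and pairwise intersecting.\<close>
  obtain a b c d where el: "a \<in> A" "b \<in> B" "c \<in> C" "d \<in> D"
    using ne by blast
  have nel: "a \<notin> B \<union> C \<union> D" "b \<notin> A \<union> C \<union> D" "c \<notin> A \<union> B \<union> D" "d \<notin> A \<union> B \<union> C"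
    using el disj by blast+
  \<comment> \<open>Each triple union omits just one ideal, so two of them share two ideals, and
    each contains \<open>A\<close> or \<open>B\<close>.\<close>
  let ?L = "[A \<union> B, A \<union> B \<union> C, A \<union> B \<union> D, A \<union> C \<union> D, B \<union> C \<union> D]"
  have li: "left_ideal A" "left_ideal B" "left_ideal C" "left_ideal D"
    using min minimal_left_idealD(1) by auto
  have "A \<union> B \<noteq> UNIV" "A \<union> B \<union> C \<noteq> UNIV" "A \<union> B \<union> D \<noteq> UNIV" "A \<union> C \<union> D \<noteq> UNIV"
      "B \<union> C \<union> D \<noteq> UNIV"
    using nel by blast+
  then have verts: "set ?L \<subseteq> ideal_graph_verts"
    using li by (simp add: ideal_graph_verts_def nontrivial_left_ideal_def left_ideal_Un)
  have "A \<union> B \<noteq> A \<union> B \<union> C" "A \<union> B \<noteq> A \<union> B \<union> D" "A \<union> B \<noteq> A \<union> C \<union> D" "A \<union> B \<noteq> B \<union> C \<union> D"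
    "A \<union> B \<union> C \<noteq> A \<union> B \<union> D" "A \<union> B \<union> C \<noteq> A \<union> C \<union> D" "A \<union> B \<union> C \<noteq> B \<union> C \<union> D"
    "A \<union> B \<union> D \<noteq> A \<union> C \<union> D" "A \<union> B \<union> D \<noteq> B \<union> C \<union> D" "A \<union> C \<union> D \<noteq> B \<union> C \<union> D"
    using el nel by blast+
  then have distL: "distinct ?L"
    by simp
  have meet: "I \<inter> J \<noteq> {}" if "I \<in> set ?L" "J \<in> set ?L" for I J
  proof -
    have "\<exists>x\<in>{a, b, c, d}. x \<in> I \<and> x \<in> J"
      using that by (simp, elim disjE; simp add: el)
    then show ?thesis by blast
  qed
  have "complete_edges (set ?L) \<subseteq> ideal_graph_edges"
  proof
    fix e
    assume "e \<in> complete_edges (set ?L)"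
    then obtain I J where IJ: "e = {I, J}" "I \<in> set ?L" "J \<in> set ?L" "I \<noteq> J"
      unfolding complete_edges_def by blast
    show "e \<in> ideal_graph_edges"
      unfolding ideal_graph_edges_def
      using IJ(1,4) meet[OF IJ(2,3)] subsetD[OF verts IJ(2)] subsetD[OF verts IJ(3)] by blast
  qed
  then have "planar (set ?L) (complete_edges (set ?L))"
    by (rule planar_subgraph[OF pl verts])
  with K5_not_planar[OF distL] show False
    by simp
qed

text \<open>Finiteness is claimed separately because \<open>card\<close> is 0 on infinite sets.
  Whichever part fails, there are four distinct minimal left ideals.\<close>

lemma planar_imp_card_Min_left_ideals_le_3:
  assumes "planar (ideal_graph_verts :: 'a::semigroup_mult set set) ideal_graph_edges"
  shows "finite (Min_left_ideals :: 'a set set) \<and> card (Min_left_ideals :: 'a set set) \<le> 3"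
proof (rule ccontr)
  assume neg: "\<not> ?thesis"
  have "\<exists>T \<subseteq> (Min_left_ideals :: 'a set set). finite T \<and> card T = 4"
  proof (cases "finite (Min_left_ideals :: 'a set set)")
    case True
    with neg obtain T where "T \<subseteq> (Min_left_ideals :: 'a set set)" "card T = 4" "finite T"
      using obtain_subset_with_card_n[of 4 "Min_left_ideals :: 'a set set"] by auto
    then show ?thesis by blast
  qed (metis infinite_arbitrarily_large)
  then obtain T :: "'a set set" where T: "T \<subseteq> Min_left_ideals" "card T = 4"
    by blast
  then obtain A B C D where "T = {A, B, C, D}" "distinct [A, B, C, D]"
    by (auto simp: numeral_eq_Suc card_Suc_eq)
  with T(1) four_minimal_left_ideals_not_planar[of A B C D] assms show False
    by (auto simp: Min_left_ideals_def)
qed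

lemma ideal_graph_planar_if_union_of_le_3:
  fixes M :: "'a::semigroup_mult set set"
  assumes M: "M \<subseteq> Min_left_ideals" "finite M" "card M \<le> 3" "\<Union>M = UNIV"
  shows "planar (ideal_graph_verts :: 'a set set) ideal_graph_edges"
proof -
  have min: "minimal_left_ideal N" if "N \<in> M" for N
    using that M(1) by (auto simp: Min_left_ideals_def)
  have sd: "N \<subseteq> I \<or> N \<inter> I = {}" "I \<noteq> {}" "I \<noteq> UNIV"
    if "N \<in> M" "I \<in> ideal_graph_verts" for N I
    using that minimal_left_ideal_subset_or_disjoint[OF min]
    by (auto simp: ideal_graph_verts_def nontrivial_left_ideal_def left_ideal_def)
  consider "card M = 0" | "card M = 1" | "card M = 2" | "card M = 3"
    using M(3) by linarith
  then show ?thesis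
  proof cases
    \<comment> \<open>The empty union cannot be the whole semigroup, whose carrier is a nonempty
      type.\<close>
    case 1
    then show ?thesis
      using M(2,4) by auto
  next
    \<comment> \<open>A single minimal left ideal would have to be all of \<open>S\<close>, but
      minimal left ideals are nontrivial.\<close>
    case 2
    then show ?thesis
      using M(4) min minimal_left_idealD(3) by (auto simp: card_1_singleton_iff)
  next
    case 3
    then obtain A B where AB: "M = {A, B}" "A \<noteq> B"
      by (auto simp: card_2_iff)
    have disj: "A \<inter> B = {}"
      using AB min minimal_left_ideals_disjoint by blast
    have verts: "ideal_graph_verts \<subseteq> {A, B}"
    proof
      fix I :: "'a set"
      assume I: "I \<in> ideal_graph_verts"
      have "A \<union> B = UNIV"
        using AB M(4) by simp
      with sd[of A I] sd[of B I] I AB(1) show "I \<in> {A, B}"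
        by auto
    qed
    then have "(ideal_graph_edges :: 'a set set set) = {}"
      using disj by (auto simp: ideal_graph_edges_def)
    \<comment> \<open>Without edges, any injective placement is a drawing; here \<open>A\<close>
      goes to 1 and \<open>B\<close> to 0.\<close>
    moreover have "inj_on (\<lambda>I. of_bool (I = A) :: complex) ideal_graph_verts"
      using verts by (auto simp: inj_on_def)
    ultimately show ?thesis
      by (auto simp: planar_def plane_drawing_def)
  next
    case 4
    then obtain A B C where ABC: "M = {A, B, C}" "A \<noteq> B" "B \<noteq> C" "A \<noteq> C"
      by (auto simp: card_3_iff)
    define V where "V = {A, B, C, A \<union> B, B \<union> C, A \<union> C}"
    have ne: "A \<noteq> {}" "B \<noteq> {}" "C \<noteq> {}"
      using ABC min minimal_left_idealD(2) by blast+
    have disj: "A \<inter> B = {}" "A \<inter> C = {}" "B \<inter> C = {}"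
      using ABC min minimal_left_ideals_disjoint by blast+
    have verts: "ideal_graph_verts \<subseteq> V"
    proof
      fix I :: "'a set"
      assume I: "I \<in> ideal_graph_verts"
      have un: "A \<union> B \<union> C = UNIV"
        using ABC M(4) by auto
      \<comment> \<open>\<open>I\<close> is the union of its traces on the three blocks, each trace
        being full or empty. All empty contradicts \<open>I \<noteq> {}\<close>, all full
        contradicts properness, and the six remaining cases are the members of
        \<open>V\<close>.\<close>
      have I_eq: "I = (A \<inter> I) \<union> (B \<inter> I) \<union> (C \<inter> I)"
        using un by blast
      have cases: "A \<inter> I = A \<or> A \<inter> I = {}" "B \<inter> I = B \<or> B \<inter> I = {}" "C \<inter> I = C \<or> C \<inter> I = {}"
        using sd(1)[of A I] sd(1)[of B I] sd(1)[of C I] I ABC(1) by blast+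
      have "I \<noteq> {}" "I \<noteq> A \<union> B \<union> C"
        using sd(2,3)[of A I] I ABC(1) un by simp_all
      then show "I \<in> V"
        unfolding V_def using cases
        by (elim disjE; subst (asm) (1 2) I_eq; subst I_eq; simp)
    qed
    then have "ideal_graph_edges \<subseteq> {{I, J} | I J. I \<in> V \<and> J \<in> V \<and> I \<noteq> J \<and> I \<inter> J \<noteq> {}}"
      by (auto simp: ideal_graph_edges_def)
    then show ?thesis
      using planar_subgraph[OF planar_three_sets[OF ne disj V_def] verts] by blast
  qed
qed

theorem theorem4p2:
  shows "(planar (ideal_graph_verts :: 'a::semigroup_mult set set) ideal_graph_edges \<longrightarrow>
            finite (Min_left_ideals :: 'a set set) \<and> card (Min_left_ideals :: 'a set set) \<le> 3) \<and>
         (\<forall>n::nat. (\<exists>M \<subseteq> (Min_left_ideals :: 'a set set). finite M \<and> card M = n \<and> \<Union>M = UNIV) \<longrightarrow>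
            (planar (ideal_graph_verts :: 'a set set) ideal_graph_edges \<longleftrightarrow> n \<le> 3))"
proof (intro conjI allI impI)
  assume "planar (ideal_graph_verts :: 'a set set) ideal_graph_edges"
  then show "finite (Min_left_ideals :: 'a set set)" "card (Min_left_ideals :: 'a set set) \<le> 3"
    using planar_imp_card_Min_left_ideals_le_3 by blast+
next
  fix n :: nat
  assume "\<exists>M \<subseteq> (Min_left_ideals :: 'a set set). finite M \<and> card M = n \<and> \<Union>M = UNIV"
  then obtain M :: "'a set set" where
    M: "M \<subseteq> Min_left_ideals" "finite M" "card M = n" "\<Union>M = UNIV"
    by blast
  show "planar (ideal_graph_verts :: 'a set set) ideal_graph_edges \<longleftrightarrow> n \<le> 3"
  proof
    assume "planar (ideal_graph_verts :: 'a set set) ideal_graph_edges"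
    then show "n \<le> 3"
      using planar_imp_card_Min_left_ideals_le_3 card_mono[OF _ M(1)] M(3) by fastforce
  next
    assume "n \<le> 3"
    then show "planar (ideal_graph_verts :: 'a set set) ideal_graph_edges"
      using ideal_graph_planar_if_union_of_le_3 M by blast
  qed
qed

end
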